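(* Let $n\ge 1$, let $\mathscr{A}\subseteq(2\mathbb{N})^n$ and $\mathscr{B}\subseteq\mathbb{N}^n$ be finite sets, let $c_{\alpha}>0$ for $\alpha\in\mathscr{A}$ and $d_{\beta}>0$ for $\beta\in\mathscr{B}$ be real numbers, and let $$f(\mathbf{x})=\sum_{\alpha\in\mathscr{A}}c_{\alpha}\mathbf{x}^{\alpha}-\sum_{\beta\in\mathscr{B}}d_{\beta}\mathbf{x}^{\beta}\in\mathbb{R}[x_1,\ldots,x_n].$$ Suppose that $\dim(\mathrm{New}(f))=n$, that $\mathscr{B}\subseteq\mathrm{New}(f)^{\circ}\cap\mathbb{N}^n$, and that the polytope $\mathrm{conv}(\mathscr{A}\cup\{\mathbf{0}\})$ is simple at $\mathbf{0}$. If $\mathbf{0}$ is not a global minimizer of $f$ (over $\mathbb{R}^n$), then $f$ has a global minimizer (over $\mathbb{R}^n$) that lies in $\mathbb{R}_{+}^n$.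
   Context: $\mathbb{N}=\{0,1,2,\ldots\}$; $2\mathbb{N}$ is the set of even nonnegative integers; $\mathbb{R}_+$ is the set of (strictly) positive real numbers. For $\alpha=(\alpha_1,\ldots,\alpha_n)$, $\mathbf{x}^{\alpha}=x_1^{\alpha_1}\cdots x_n^{\alpha_n}$. $\mathrm{conv}$ denotes convex hull. The support $\mathrm{supp}(f)$ of a polynomial is the set of exponent vectors with nonzero coefficient, and its Newton polytope is $\mathrm{New}(f)=\mathrm{conv}(\mathrm{supp}(f))$. For a polytope $P$, $P^{\circ}$ denotes its interior. A polytope $\Delta$ of dimension $d$ is called simple at a vertex $v$ of $\Delta$ if $v$ is the intersection of precisely $d$ edges of $\Delta$ (i.e. exactly $d$ edges of $\Delta$ contain $v$). *)

theory Defs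
  imports "HOL-Analysis.Analysis" "HOL-Library.Poly_Mapping"
begin

text \<open>
  Real polynomials in variables indexed by the finite type \<open>'n\<close> are finitely supported maps
  from exponent vectors to coefficients; the support of a polynomial \<open>f\<close> is \<open>keys f\<close>.
\<close>

type_synonym 'n rpoly = "(nat ^ 'n) \<Rightarrow>\<^sub>0 real"

definition eval_rpoly :: "'n::finite rpoly \<Rightarrow> real ^ 'n \<Rightarrow> real" where
  "eval_rpoly f x =
     (\<Sum>\<alpha>\<in>Poly_Mapping.keys f. Poly_Mapping.lookup f \<alpha> * (\<Prod>i\<in>UNIV. (x $ i) ^ (\<alpha> $ i)))"

definition real_vec :: "nat ^ 'n \<Rightarrow> real ^ 'n::finite" where
  "real_vec \<alpha> = (\<chi> i. real (\<alpha> $ i))"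

definition newton_polytope :: "'n::finite rpoly \<Rightarrow> (real ^ 'n) set" where
  "newton_polytope f = convex hull (real_vec ` Poly_Mapping.keys f)"

definition simple_at :: "'a::euclidean_space set \<Rightarrow> 'a \<Rightarrow> bool" where
  "simple_at \<Delta> v \<longleftrightarrow>
     polytope \<Delta> \<and> v extreme_point_of \<Delta> \<and>
     int (card {e. e edge_of \<Delta> \<and> v \<in> e}) = aff_dim \<Delta>"

definition global_minimizer :: "('a \<Rightarrow> real) \<Rightarrow> 'a \<Rightarrow> bool" where
  "global_minimizer g x \<longleftrightarrow> (\<forall>y. g x \<le> g y)"

text \<open>
  The two sums are subtracted as polynomials, so \<open>A\<close> and \<open>B\<close> may overlap, and an exponent
  whose coefficients cancel does not belong to the support.
\<close>

definition signed_sum ::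
  "(nat ^ 'n) set \<Rightarrow> (nat ^ 'n \<Rightarrow> real) \<Rightarrow> (nat ^ 'n) set \<Rightarrow> (nat ^ 'n \<Rightarrow> real) \<Rightarrow> 'n::finite rpoly" where
  "signed_sum A c B d =
     (\<Sum>\<alpha>\<in>A. Poly_Mapping.single \<alpha> (c \<alpha>)) - (\<Sum>\<beta>\<in>B. Poly_Mapping.single \<beta> (d \<beta>))"

end

theory Submission imports Defs begin

text \<open>
  On the open positive orthant write \<open>x = exp L\<close> coordinatewise, so that \<open>f\<close> becomes the exponential
  sum \<open>h L = (\<Sum>\<alpha>\<in>A. c \<alpha> * exp (\<alpha> \<bullet> L)) - (\<Sum>\<beta>\<in>B. d \<beta> * exp (\<beta> \<bullet> L))\<close>. The vertices of the Newton
  polytope are exponents from \<open>A \<union> B\<close> that are not interior, so they lie in \<open>A\<close>; hence \<open>B\<close>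
  lies in the interior of \<open>P = conv (A \<union> {0})\<close>. With \<open>m L\<close> the maximum of \<open>p \<bullet> L\<close> over \<open>p \<in> P\<close> this
  gives a uniform \<open>e > 0\<close> with \<open>\<beta> \<bullet> L + e * norm L \<le> m L\<close> for all \<open>\<beta> \<in> B\<close> and all \<open>L\<close>.

  This inequality bounds every sublevel set \<open>{L. h L \<le> k}\<close> with \<open>k < f 0\<close>
  (lemma \<open>bounded_sublevel_exp_sum\<close>). It implies \<open>\<beta> \<bullet> L \<le> \<theta> * m L\<close> with a fixed \<open>\<theta> < 1\<close>,
  so \<open>h\<close> is large where \<open>m L\<close> is large, and \<open>m\<close> is bounded above on the sublevel set. Since \<open>0\<close> is a
  vertex of \<open>P\<close>, it is not in \<open>B\<close>, so \<open>f 0\<close> is the constant term contributed by \<open>A\<close> and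
  \<open>h L \<le> k\<close> forces some \<open>\<beta> \<bullet> L\<close> to be bounded below. Then \<open>e * norm L \<le> m L - \<beta> \<bullet> L\<close> is bounded.

  All exponents in \<open>A\<close> being even, \<open>f\<close> does not increase when a point is replaced by its coordinatewise
  absolute value, and the open orthant is dense in the closed one. So if \<open>f\<close> takes a value below \<open>f 0\<close>,
  it does so in the open orthant, \<open>h\<close> attains its minimum by compactness, and that minimum is global
  for \<open>f\<close>.
\<close>

section \<open>Exponential sums with dominated negative part\<close>

text \<open>
  The quantity \<open>Max ((\<lambda>v. v \<bullet> L) ` S)\<close> is the support function of \<open>conv S\<close> in direction \<open>L\<close>.
\<close>

lemma inner_le_Max_convex_hull:
  fixes S :: "'a::real_inner set"
  assumes "finite S" "q \<in> convex hull S"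
  shows "q \<bullet> L \<le> Max ((\<lambda>v. v \<bullet> L) ` S)"
proof -
  have "S \<subseteq> {v. L \<bullet> v \<le> Max ((\<lambda>v. v \<bullet> L) ` S)}"
    using assms(1) by (auto simp: inner_commute intro!: Max_ge)
  then have "convex hull S \<subseteq> {v. L \<bullet> v \<le> Max ((\<lambda>v. v \<bullet> L) ` S)}"
    by (intro hull_minimal convex_halfspace_le)
  with assms(2) show ?thesis
    by (auto simp: inner_commute)
qed

text \<open>
  A finite set in the interior of a polytope keeps a uniform distance from the boundary; the support
  function measures this in every direction.
\<close>

lemma interior_hull_support_gap:
  fixes S T :: "'a::euclidean_space set"
  assumes "finite S" "finite T" "T \<subseteq> interior (convex hull S)"
  obtains e where "e > 0"
    "\<And>q L. q \<in> T \<Longrightarrow> q \<bullet> L + e * norm L \<le> Max ((\<lambda>v. v \<bullet> L) ` S)"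
proof -
  obtain e where e: "e > 0" "(\<Union>q\<in>T. ball q e) \<subseteq> interior (convex hull S)"
    using compact_subset_open_imp_ball_epsilon_subset
      [OF finite_imp_compact[OF assms(2)] open_interior assms(3)] by blast
  have "q \<bullet> L + e / 2 * norm L \<le> Max ((\<lambda>v. v \<bullet> L) ` S)" if "q \<in> T" for q L
  proof -
    let ?q = "q + (e / 2) *\<^sub>R sgn L"
    have "norm (sgn L) \<le> 1"
      by (simp add: norm_sgn)
    then have "e / 2 * norm (sgn L) \<le> e / 2 * 1"
      using e(1) by (intro mult_left_mono) auto
    then have "?q \<in> ball q e"
      using e(1) by (simp add: dist_norm)
    then have "?q \<in> convex hull S"
      using e(2) that interior_subset by blast
    then have "?q \<bullet> L \<le> Max ((\<lambda>v. v \<bullet> L) ` S)"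
      by (rule inner_le_Max_convex_hull[OF assms(1)])
    moreover have "sgn L \<bullet> L = norm L"
      by (cases "L = 0") (simp_all add: sgn_div_norm dot_square_norm power2_eq_square)
    ultimately show ?thesis
      by (simp add: inner_add_left)
  qed
  then show thesis
    using that[of "e / 2"] e(1) by simp
qed

lemma exp_dominates_exp_scaled:
  fixes a D k \<theta> :: real
  assumes "a > 0" "\<theta> < 1"
  obtains M where "M \<ge> 0" "\<And>m. m \<ge> M \<Longrightarrow> k < a * exp m - D * exp (\<theta> * m)"
proof -
  have "((\<lambda>m. a - D * exp ((\<theta> - 1) * m)) \<longlongrightarrow> a - D * 0) at_top"
    using assms(2) by real_asymp
  then have lim: "filterlim (\<lambda>m. (a - D * exp ((\<theta> - 1) * m)) * exp m) at_top at_top"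
    using assms(1) by (intro filterlim_tendsto_pos_mult_at_top[where c = a] exp_at_top) auto
  have eq: "(a - D * exp ((\<theta> - 1) * m)) * exp m = a * exp m - D * exp (\<theta> * m)" for m
    by (simp add: algebra_simps flip: exp_add)
  have "eventually (\<lambda>m. k < a * exp m - D * exp (\<theta> * m)) at_top"
    using lim unfolding eq filterlim_at_top_dense by blast
  then obtain M where "\<And>m. m \<ge> M \<Longrightarrow> k < a * exp m - D * exp (\<theta> * m)"
    by (auto simp: eventually_at_top_linorder)
  then show thesis
    using that[of "max M 0"] by auto
qed

text \<open>
  The exponential sum with exponents \<open>p a\<close> (positive coefficients, \<open>a \<in> A\<close>) and \<open>p b\<close> (negative
  coefficients, \<open>b \<in> B\<close>).
\<close>

definition exp_sum_diff ::
  "('i \<Rightarrow> 'a::real_inner) \<Rightarrow> 'i set \<Rightarrow> ('i \<Rightarrow> real) \<Rightarrow> 'i set \<Rightarrow> ('i \<Rightarrow> real) \<Rightarrow> 'a \<Rightarrow> real" where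
  "exp_sum_diff p A c B d L = (\<Sum>a\<in>A. c a * exp (p a \<bullet> L)) - (\<Sum>b\<in>B. d b * exp (p b \<bullet> L))"

text \<open>
  The bound on \<open>k\<close> is the constant term of the positive part. It cannot be relaxed to an arbitrary \<open>k\<close>:
  if all exponents have nonnegative coordinates, then no \<open>p b\<close> is \<open>0\<close> by the interior condition, and
  the sum converges to that constant when all coordinates of \<open>L\<close> tend to \<open>-\<infinity>\<close>.
\<close>

lemma bounded_sublevel_exp_sum:
  fixes p :: "'i \<Rightarrow> 'a::euclidean_space"
  assumes fin: "finite A" "finite B"
    and c: "\<And>a. a \<in> A \<Longrightarrow> c a > 0" and d: "\<And>b. b \<in> B \<Longrightarrow> d b > 0"
    and int: "p ` B \<subseteq> interior (convex hull (p ` A \<union> {0}))"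
    and k: "k < (\<Sum>a | a \<in> A \<and> p a = 0. c a)"
  shows "bounded {L. exp_sum_diff p A c B d L \<le> k}"
proof -
  define m where "m L = Max ((\<lambda>v. v \<bullet> L) ` (p ` A \<union> {0}))" for L
  define D where "D = sum d B"
  have D: "D \<ge> 0"
    unfolding D_def using d by (intro sum_nonneg) (auto intro: less_imp_le)
  have m_in: "m L \<in> (\<lambda>v. v \<bullet> L) ` (p ` A \<union> {0})" for L
    unfolding m_def using fin by (intro Max_in) auto
  have "finite (p ` A \<union> {0})" "finite (p ` B)"
    using fin by auto
  then obtain e where e: "e > 0" and
    "\<And>q L. q \<in> p ` B \<Longrightarrow> q \<bullet> L + e * norm L \<le> Max ((\<lambda>v. v \<bullet> L) ` (p ` A \<union> {0}))"
    using interior_hull_support_gap[OF _ _ int] by blast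
  then have gap: "p b \<bullet> L + e * norm L \<le> m L" if "b \<in> B" for b L
    unfolding m_def using that by (meson imageI)
  obtain R where R: "R > 0" "\<And>b. b \<in> B \<Longrightarrow> norm (p b) \<le> R"
    using finite_imp_bounded[of "p ` B"] fin(2) unfolding bounded_pos by auto
  define \<theta> where "\<theta> = R / (R + e)"
  have \<theta>: "\<theta> < 1"
    using R(1) e by (simp add: \<theta>_def)
  \<comment> \<open>The gap in terms of \<open>norm L\<close> becomes a relative gap because \<open>p b \<bullet> L \<le> R * norm L\<close>.\<close>
  have theta: "p b \<bullet> L \<le> \<theta> * m L" if "b \<in> B" for b L
  proof -
    have "p b \<bullet> L \<le> norm (p b) * norm L"
      by (rule norm_cauchy_schwarz)
    also have "\<dots> \<le> R * norm L"
      using R(2)[OF that] by (intro mult_right_mono) auto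
    finally have "e * (p b \<bullet> L) \<le> R * (e * norm L)"
      using e by (simp add: mult.left_commute mult_left_mono)
    also have "\<dots> \<le> R * (m L - p b \<bullet> L)"
      using gap[OF that, of L] R(1) by (intro mult_left_mono) auto
    finally show ?thesis
      using R(1) e by (simp add: \<theta>_def field_simps)
  qed
  obtain a where a: "a > 0" "\<And>i. i \<in> A \<Longrightarrow> a \<le> c i"
  proof (cases "A = {}")
    case False
    then show thesis
      using that[of "Min (c ` A)"] fin(1) c by auto
  qed (use that[of 1] in auto)
  obtain M where M: "M \<ge> 0" "\<And>t. t \<ge> M \<Longrightarrow> k < a * exp t - D * exp (\<theta> * t)"
    using exp_dominates_exp_scaled[OF a(1) \<theta>] by blast
  define \<delta> where "\<delta> = (\<Sum>a | a \<in> A \<and> p a = 0. c a) - k"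
  have \<delta>: "\<delta> > 0"
    using k by (simp add: \<delta>_def)
  have "norm L \<le> (M - ln (\<delta> / (D + 1))) / e" if L: "exp_sum_diff p A c B d L \<le> k" for L
  proof -
    have "m L \<le> M"
    proof (rule ccontr)
      assume "\<not> m L \<le> M"
      then have less: "k < a * exp (m L) - D * exp (\<theta> * m L)" and pos: "m L > 0"
        using M by auto
      \<comment> \<open>As \<open>m L > 0\<close>, the maximum is not attained at the extra point \<open>0\<close>.\<close>
      obtain i where i: "i \<in> A" "p i \<bullet> L = m L"
        using m_in[of L] pos by auto
      have "a * exp (m L) \<le> c i * exp (p i \<bullet> L)"
        using a(2)[OF i(1)] i(2) by simp
      also have "\<dots> \<le> (\<Sum>a\<in>A. c a * exp (p a \<bullet> L))"
        using i(1) fin(1) c by (intro member_le_sum) (auto intro: less_imp_le)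
      finally have 1: "a * exp (m L) \<le> (\<Sum>a\<in>A. c a * exp (p a \<bullet> L))" .
      have "(\<Sum>b\<in>B. d b * exp (p b \<bullet> L)) \<le> (\<Sum>b\<in>B. d b * exp (\<theta> * m L))"
        using theta d by (intro sum_mono mult_left_mono) (auto intro: less_imp_le)
      also have "\<dots> = D * exp (\<theta> * m L)"
        by (simp add: D_def sum_distrib_right)
      finally show False
        using 1 less L by (simp add: exp_sum_diff_def)
    qed
    have "(\<Sum>a | a \<in> A \<and> p a = 0. c a) = (\<Sum>a | a \<in> A \<and> p a = 0. c a * exp (p a \<bullet> L))"
      by (intro sum.cong) auto
    also have "\<dots> \<le> (\<Sum>a\<in>A. c a * exp (p a \<bullet> L))"
      using fin(1) c by (intro sum_mono2) (auto intro: less_imp_le)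
    finally have ge: "\<delta> \<le> (\<Sum>b\<in>B. d b * exp (p b \<bullet> L))"
      using L by (simp add: exp_sum_diff_def \<delta>_def)
    \<comment> \<open>The denominator \<open>D + 1\<close> instead of \<open>D\<close> also covers \<open>B = {}\<close>, where \<open>D = 0\<close>.\<close>
    have "\<exists>b\<in>B. \<delta> / (D + 1) \<le> exp (p b \<bullet> L)"
    proof (rule ccontr)
      assume "\<not> (\<exists>b\<in>B. \<delta> / (D + 1) \<le> exp (p b \<bullet> L))"
      then have "(\<Sum>b\<in>B. d b * exp (p b \<bullet> L)) \<le> (\<Sum>b\<in>B. d b * (\<delta> / (D + 1)))"
        using d by (intro sum_mono mult_left_mono) (auto simp: not_le intro: less_imp_le)
      also have "\<dots> = D * (\<delta> / (D + 1))"
        unfolding D_def sum_distrib_right ..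
      also have "\<dots> < \<delta>"
        using D \<delta> by (simp add: field_simps)
      finally show False
        using ge by simp
    qed
    then obtain b where b: "b \<in> B" "\<delta> / (D + 1) \<le> exp (p b \<bullet> L)"
      by blast
    have "ln (\<delta> / (D + 1)) \<le> ln (exp (p b \<bullet> L))"
      using b(2) \<delta> D by (subst ln_le_cancel_iff) auto
    then have "e * norm L \<le> M - ln (\<delta> / (D + 1))"
      using gap[OF b(1), of L] \<open>m L \<le> M\<close> by simp
    then show ?thesis
      using e by (simp add: field_simps)
  qed
  then show ?thesis
    by (auto simp: bounded_iff)
qed

lemma exp_sum_diff_attains_inf:
  fixes p :: "'i \<Rightarrow> 'a::euclidean_space"
  assumes fin: "finite A" "finite B"
    and c: "\<And>a. a \<in> A \<Longrightarrow> c a > 0" and d: "\<And>b. b \<in> B \<Longrightarrow> d b > 0"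
    and int: "p ` B \<subseteq> interior (convex hull (p ` A \<union> {0}))"
    and L0: "exp_sum_diff p A c B d L0 < (\<Sum>a | a \<in> A \<and> p a = 0. c a)"
  obtains L where "global_minimizer (exp_sum_diff p A c B d) L"
proof -
  let ?h = "exp_sum_diff p A c B d"
  let ?K = "{L. ?h L \<le> ?h L0}"
  have cont: "continuous_on UNIV ?h"
    unfolding exp_sum_diff_def by (intro continuous_intros)
  have "closed ?K"
    using cont by (intro closed_Collect_le) auto
  moreover have "bounded ?K"
    using assms by (rule bounded_sublevel_exp_sum)
  ultimately have "compact ?K"
    by (simp add: compact_eq_bounded_closed)
  moreover have "L0 \<in> ?K"
    by simp
  moreover have "continuous_on ?K ?h"
    using cont by (rule continuous_on_subset) simp
  ultimately obtain L where L: "L \<in> ?K" "\<And>y. y \<in> ?K \<Longrightarrow> ?h L \<le> ?h y"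
    by (metis continuous_attains_inf empty_iff)
  have "?h L \<le> ?h y" for y
    using L(1) L(2)[of y] by (cases "y \<in> ?K") auto
  then show thesis
    using that by (auto simp: global_minimizer_def)
qed

section \<open>Signed sums of monomials\<close>

lemma eval_rpoly_superset:
  assumes "finite S" "Poly_Mapping.keys f \<subseteq> S"
  shows "eval_rpoly f x = (\<Sum>\<alpha>\<in>S. Poly_Mapping.lookup f \<alpha> * (\<Prod>i\<in>UNIV. (x $ i) ^ (\<alpha> $ i)))"
  unfolding eval_rpoly_def using assms
  by (intro sum.mono_neutral_left) (auto simp: in_keys_iff)

lemma lookup_signed_sum:
  assumes "finite A" "finite B"
  shows "Poly_Mapping.lookup (signed_sum A c B d) \<alpha>
    = (if \<alpha> \<in> A then c \<alpha> else 0) - (if \<alpha> \<in> B then d \<alpha> else 0)"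
  using assms
  by (simp add: signed_sum_def lookup_minus lookup_sum lookup_single when_def)

lemma keys_signed_sum:
  assumes "finite A" "finite B"
  shows "Poly_Mapping.keys (signed_sum A c B d) \<subseteq> A \<union> B"
  by (auto simp: in_keys_iff lookup_signed_sum[OF assms] split: if_splits)

lemma eval_signed_sum:
  assumes "finite A" "finite B"
  shows "eval_rpoly (signed_sum A c B d) x
    = (\<Sum>\<alpha>\<in>A. c \<alpha> * (\<Prod>i\<in>UNIV. (x $ i) ^ (\<alpha> $ i)))
      - (\<Sum>\<beta>\<in>B. d \<beta> * (\<Prod>i\<in>UNIV. (x $ i) ^ (\<beta> $ i)))"
proof -
  let ?m = "\<lambda>\<alpha>. \<Prod>i\<in>UNIV. (x $ i) ^ (\<alpha> $ i)"
  have "eval_rpoly (signed_sum A c B d) x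
    = (\<Sum>\<alpha>\<in>A \<union> B. (if \<alpha> \<in> A then c \<alpha> * ?m \<alpha> else 0) - (if \<alpha> \<in> B then d \<alpha> * ?m \<alpha> else 0))"
    unfolding eval_rpoly_superset[OF finite_UnI[OF assms] keys_signed_sum[OF assms]]
    by (intro sum.cong) (auto simp: lookup_signed_sum[OF assms] left_diff_distrib)
  also have "\<dots> = (\<Sum>\<alpha>\<in>(A \<union> B) \<inter> A. c \<alpha> * ?m \<alpha>) - (\<Sum>\<alpha>\<in>(A \<union> B) \<inter> B. d \<alpha> * ?m \<alpha>)"
    using assms by (simp add: sum_subtractf flip: sum.inter_restrict)
  finally show ?thesis
    by (simp add: Int_absorb1)
qed

lemma real_vec_eq_0_iff: "real_vec \<alpha> = 0 \<longleftrightarrow> \<alpha> = 0"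
  by (simp add: real_vec_def vec_eq_iff)

lemma monomial_exp:
  "(\<Prod>i\<in>UNIV. ((\<chi> i. exp (L $ i)) $ i) ^ (\<alpha> $ i)) = exp (real_vec \<alpha> \<bullet> L)"
  by (simp add: real_vec_def inner_vec_def exp_sum exp_of_nat_mult)

lemma monomial_at_0: "(\<Prod>i\<in>UNIV. (0 $ i :: real) ^ (\<alpha> $ i)) = (if \<alpha> = 0 then 1 else 0)"
  by (auto simp: vec_eq_iff)

lemma eval_signed_sum_exp:
  assumes "finite A" "finite B"
  shows "eval_rpoly (signed_sum A c B d) (\<chi> i. exp (L $ i)) = exp_sum_diff real_vec A c B d L"
  unfolding eval_signed_sum[OF assms] exp_sum_diff_def monomial_exp ..

text \<open>
  Every vertex of the Newton polytope has to come from \<open>A\<close>, because points of \<open>B\<close> are interior.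
\<close>

lemma newton_polytope_signed_sum_subset:
  assumes "finite A" "finite B"
    and "real_vec ` B \<subseteq> interior (newton_polytope (signed_sum A c B d))"
  shows "newton_polytope (signed_sum A c B d) \<subseteq> convex hull (real_vec ` A)"
proof -
  let ?f = "signed_sum A c B d"
  let ?S = "real_vec ` Poly_Mapping.keys ?f"
  have "{v. v extreme_point_of (convex hull ?S)} \<subseteq> real_vec ` A"
  proof safe
    fix v assume v: "v extreme_point_of (convex hull ?S)"
    then have "v \<in> real_vec ` (A \<union> B)"
      using extreme_point_of_convex_hull keys_signed_sum[OF assms(1,2)] by blast
    moreover have "v \<notin> real_vec ` B"
      using v extreme_point_not_in_interior assms(3) by (auto simp: newton_polytope_def)
    ultimately show "v \<in> real_vec ` A"
      by blast
  qed
  moreover have "convex hull ?S = convex hull {v. v extreme_point_of (convex hull ?S)}"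
    by (intro Krein_Milman_Minkowski) (auto intro: finite_imp_compact_convex_hull)
  ultimately show ?thesis
    unfolding newton_polytope_def by (metis hull_mono)
qed

lemma eval_signed_sum_abs_le:
  assumes "finite A" "finite B" "\<forall>\<alpha>\<in>A. \<forall>i. even (\<alpha> $ i)" "\<forall>\<beta>\<in>B. d \<beta> > 0"
  shows "eval_rpoly (signed_sum A c B d) (\<chi> i. \<bar>x $ i\<bar>) \<le> eval_rpoly (signed_sum A c B d) x"
proof -
  have "(\<Sum>\<alpha>\<in>A. c \<alpha> * (\<Prod>i\<in>UNIV. \<bar>x $ i\<bar> ^ (\<alpha> $ i)))
    = (\<Sum>\<alpha>\<in>A. c \<alpha> * (\<Prod>i\<in>UNIV. (x $ i) ^ (\<alpha> $ i)))"
    using assms(3) by (intro sum.cong refl arg_cong2[where f = "(*)"] prod.cong) (auto simp: power_even_abs)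
  moreover have "(\<Sum>\<beta>\<in>B. d \<beta> * (\<Prod>i\<in>UNIV. (x $ i) ^ (\<beta> $ i)))
    \<le> (\<Sum>\<beta>\<in>B. d \<beta> * (\<Prod>i\<in>UNIV. \<bar>x $ i\<bar> ^ (\<beta> $ i)))"
  proof (intro sum_mono mult_left_mono)
    fix \<beta>
    have "(\<Prod>i\<in>UNIV. (x $ i) ^ (\<beta> $ i)) \<le> \<bar>\<Prod>i\<in>UNIV. (x $ i) ^ (\<beta> $ i)\<bar>"
      by (rule abs_ge_self)
    also have "\<dots> = (\<Prod>i\<in>UNIV. \<bar>x $ i\<bar> ^ (\<beta> $ i))"
      by (simp add: abs_prod power_abs)
    finally show "(\<Prod>i\<in>UNIV. (x $ i) ^ (\<beta> $ i)) \<le> (\<Prod>i\<in>UNIV. \<bar>x $ i\<bar> ^ (\<beta> $ i))" .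
  qed (use assms(4) in \<open>auto intro: less_imp_le\<close>)
  ultimately show ?thesis
    by (simp add: eval_signed_sum[OF assms(1,2)])
qed

lemma eval_rpoly_shift_tendsto:
  "((\<lambda>t. eval_rpoly f (\<chi> i. x $ i + t)) \<longlongrightarrow> eval_rpoly f x) (at_right 0)"
proof -
  have "((\<lambda>t. eval_rpoly f (\<chi> i. x $ i + t)) \<longlongrightarrow> eval_rpoly f (\<chi> i. x $ i + 0)) (at_right 0)"
    unfolding eval_rpoly_def by (simp del: add_0_right) (intro tendsto_intros)
  then show ?thesis
    by simp
qed

section \<open>Minimizers in the positive orthant\<close>

theorem theorem3p4:
  fixes A B :: "(nat ^ 'n::finite) set" and c d :: "nat ^ 'n \<Rightarrow> real" and f :: "'n rpoly"
  assumes "finite A" and "finite B"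
    and "\<forall>\<alpha>\<in>A. \<forall>i. even (\<alpha> $ i)"
    and "\<forall>\<alpha>\<in>A. c \<alpha> > 0" and "\<forall>\<beta>\<in>B. d \<beta> > 0"
    and "f = signed_sum A c B d"
    and "aff_dim (newton_polytope f) = int CARD('n)"
    and "real_vec ` B \<subseteq> interior (newton_polytope f)"
    and "simple_at (convex hull (real_vec ` A \<union> {0})) 0"
    and "\<not> global_minimizer (eval_rpoly f) 0"
  shows "\<exists>x. global_minimizer (eval_rpoly f) x \<and> (\<forall>i. x $ i > 0)"
proof -
  let ?P = "convex hull (real_vec ` A \<union> {0})"
  let ?h = "exp_sum_diff real_vec A c B d"
  have "newton_polytope f \<subseteq> convex hull (real_vec ` A)"
    unfolding assms(6) by (rule newton_polytope_signed_sum_subset[OF assms(1,2) assms(8)[unfolded assms(6)]])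
  also have "\<dots> \<subseteq> ?P"
    by (intro hull_mono) auto
  finally have B: "real_vec ` B \<subseteq> interior ?P"
    using assms(8) interior_mono by blast
  have "0 \<notin> interior ?P"
    using assms(9) extreme_point_not_in_interior by (auto simp: simple_at_def)
  then have "0 \<notin> B"
    using B real_vec_eq_0_iff by (metis image_subset_iff)
  then have f0: "eval_rpoly f 0 = (\<Sum>\<alpha> | \<alpha> \<in> A \<and> real_vec \<alpha> = 0. c \<alpha>)"
    using assms(1,2) unfolding assms(6) eval_signed_sum[OF assms(1,2)] monomial_at_0 real_vec_eq_0_iff
    by (simp add: if_distrib Collect_conv_if conj_commute[of "_ \<in> A"] cong: if_cong)
  have h_exp: "?h L = eval_rpoly f (\<chi> i. exp (L $ i))" for L
    by (simp add: assms(6) eval_signed_sum_exp[OF assms(1,2)])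
  have h_ln: "eval_rpoly f x = ?h (\<chi> i. ln (x $ i))" if "\<And>i. x $ i > 0" for x
    unfolding h_exp using that by (intro arg_cong[where f = "eval_rpoly f"]) (simp add: vec_eq_iff)
  have abs_le: "eval_rpoly f (\<chi> i. \<bar>x $ i\<bar>) \<le> eval_rpoly f x" for x
    unfolding assms(6) by (rule eval_signed_sum_abs_le[OF assms(1-3,5)])
  \<comment> \<open>Lower bounds pass from the open orthant to the whole space: move from \<open>x\<close> to its absolute value and
    approximate that by the positive points \<open>\<bar>x\<bar> + (t, \<dots>, t)\<close> with \<open>t \<rightarrow> 0\<close>.\<close>
  have extend: "k \<le> eval_rpoly f x" if k: "\<And>L. k \<le> ?h L" for k x
  proof -
    have "k \<le> eval_rpoly f (\<chi> i. \<bar>x $ i\<bar>)"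
    proof (rule tendsto_lowerbound[OF eval_rpoly_shift_tendsto])
      have "k \<le> eval_rpoly f (\<chi> i. (\<chi> i. \<bar>x $ i\<bar>) $ i + t)" if "t > 0" for t
        using k that by (subst h_ln) (auto intro: add_nonneg_pos)
      then show "\<forall>\<^sub>F t in at_right 0. k \<le> eval_rpoly f (\<chi> i. (\<chi> i. \<bar>x $ i\<bar>) $ i + t)"
        by (intro eventually_at_right_less[THEN eventually_mono]) auto
    qed simp
    with abs_le[of x] show ?thesis
      by simp
  qed
  obtain L0 where L0: "?h L0 < eval_rpoly f 0"
    using extend[of "eval_rpoly f 0"] assms(10) unfolding global_minimizer_def by (meson not_le)
  obtain L where L: "global_minimizer ?h L"
    using assms(4,5) by (elim exp_sum_diff_attains_inf[OF assms(1,2) _ _ B L0[unfolded f0], rotated 2]) auto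
  have "global_minimizer (eval_rpoly f) (\<chi> i. exp (L $ i))"
    using extend[of "?h L"] L unfolding global_minimizer_def h_exp[symmetric] by blast
  then show ?thesis
    by (intro exI[of _ "\<chi> i. exp (L $ i)"]) simp
qed

end
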